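(* Let $n\ge 2$ and $m\ge1$ be integers. The determinant winding number induces an isomorphism (i.e. a well-defined bijection of sets) $$\mathcal V_1(C(S^1)_{(n)},m)\to\{-m(n-1),-m(n-1)+1,\ldots,m(n-1)\},\qquad [a]\mapsto \mathrm{wind}_{S^1}(\det a(z)).$$
   Context: $C(S^1)_{(n)}$ is the Fej\'er--Riesz operator system: the space of functions $a\in C(S^1)$ of the form $a(z)=\sum_{k=-n+1}^{n-1}a_kz^k$, $z\in S^1$, with $a_k\in\mathbb C$. $M_m(C(S^1)_{(n)})$ is identified with the space of functions $a(z)=\sum_{k=-n+1}^{n-1}a_kz^k$ on $S^1$ with $a_k\in M_m(\mathbb C)$, with its topology as a finite-dimensional vector space. Define $$G(C(S^1)_{(n)},m)=\{a\in M_m(C(S^1)_{(n)})\mid \det a(z)\neq0\text{ for all }z\in S^1\}$$ and let $\mathcal V_1(C(S^1)_{(n)},m):=\pi_0(G(C(S^1)_{(n)},m))$ be its set of path components. $\mathrm{wind}_{S^1}(\det a(z))$ denotes the winding number around $0$ of the closed curve $S^1\to\mathbb C\setminus\{0\}$, $z\mapsto\det a(z)$. *)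

theory Defs
  imports "HOL-Analysis.Analysis" "HOL-Complex_Analysis.Complex_Analysis"
begin

abbreviation circle :: "complex set" where
  "circle \<equiv> sphere 0 1"

text \<open>The continuous matrix-valued functions on the circle with the supremum metric. Its points are
  extensional functions, i.e. they take the value \<^const>\<open>undefined\<close> off the circle, so that two
  points are equal iff they agree on the circle.\<close>

definition circle_matrix_functions :: "(complex \<Rightarrow> complex^'m^'m) metric" where
  "circle_matrix_functions = cfunspace (top_of_set circle) euclidean_metric"

text \<open>The matrix amplification $M_m(C(S^1)_{(n)})$, with $m$ the cardinality of the index
  type. The matrix $z^k a_k$ is written as \<open>map_matrix ((*) (z powi k)) (c k)\<close>. It
  carries the topology of the supremum metric, which on this finite-dimensional space is the
  vector space topology.\<close>

definition fejer_riesz :: "nat \<Rightarrow> (complex \<Rightarrow> complex^'m^'m) set" where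
  "fejer_riesz n = {a \<in> mspace circle_matrix_functions.
     \<exists>c :: int \<Rightarrow> complex^'m^'m. \<forall>z\<in>circle.
       a z = (\<Sum>k = - int n + 1..int n - 1. map_matrix ((*) (z powi k)) (c k))}"

definition fejer_riesz_invertible :: "nat \<Rightarrow> (complex \<Rightarrow> complex^'m^'m) set" where
  "fejer_riesz_invertible n = {a \<in> fejer_riesz n. \<forall>z\<in>circle. det (a z) \<noteq> 0}"

definition fejer_riesz_invertible_topology :: "nat \<Rightarrow> (complex \<Rightarrow> complex^'m^'m) topology" where
  "fejer_riesz_invertible_topology n =
     subtopology (mtopology_of circle_matrix_functions) (fejer_riesz_invertible n)"

definition V1 :: "nat \<Rightarrow> (complex \<Rightarrow> complex^'m^'m) set set" where
  "V1 n = path_components_of (fejer_riesz_invertible_topology n)"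

definition det_winding :: "(complex \<Rightarrow> complex^'m^'m) \<Rightarrow> complex" where
  "det_winding a = winding_number (\<lambda>t. det (a (circlepath 0 1 t))) 0"

end

theory Submission
  imports Defs "HOL-Computational_Algebra.Fundamental_Theorem_Algebra"
begin

text \<open>
Multiplication by $z^{n-1}$ turns a Laurent polynomial of the Fejer--Riesz system into a matrix
polynomial of degree at most $2(n-1)$, so the question is to classify, up to deformation, the matrix
polynomials that are invertible on the circle. The claim that carries everything is a normal form:
such a polynomial can be deformed, without raising degrees and without losing invertibility on the
circle, to a diagonal matrix \<open>diag_powers c\<close> with entries $z^{c_i}$, $0 \le c_i \le 2(n-1)$
(\<open>deformable_to_diag_powers\<close>).

The normal form is proved for separate degree bounds $d_i$ on the rows, by induction on $\sum_i d_i$.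
If the matrix of the coefficients at the extreme degrees $d_i$ is singular, then a row operation lowers
the degree of some row (\<open>lower_row_degree\<close>); one may call this a zero of the determinant at
infinity. If it is nonsingular, then the determinant has degree $\sum_i d_i > 0$, hence a root $w$, and a
row operation makes some row divisible by $z-w$ (\<open>split_off_root\<close>). The root is not on the circle:
if it lies inside, it is moved to $0$, and if it lies outside, it is moved to infinity
(\<open>reduce_degree\<close>). In all cases a row of smaller degree remains. When all $d_i$ vanish, the matrix
is constant, and the general linear group over the complex numbers is path connected.

A factor $z$ can be carried from one diagonal entry to another by rotating the plane of the two
coordinates (\<open>deformable_diag_powers_swap\<close>). Hence two normal forms with equal $\sum_i c_i$ are
deformable into one another. Conversely the winding number of the determinant is invariant under
homotopy and equals $\sum_i c_i - m(n-1)$ on the component of \<open>diag_powers c\<close>. So it separates the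
components, and since $\sum_i c_i$ takes all values from $0$ to $2m(n-1)$, its range is as claimed. No
zeros have to be counted.
\<close>

\<comment> \<open>The dollar sign is kept for the entries of vectors and matrices.\<close>
no_notation fps_nth (infixl "$" 75)

section \<open>Matrix polynomials invertible on the circle\<close>

definition eval_mat :: "complex poly^'m^'m \<Rightarrow> complex \<Rightarrow> complex^'m^'m" where
  "eval_mat M z = map_matrix (\<lambda>p. poly p z) M"

lemma eval_mat_nth [simp]: "eval_mat M z $ i $ j = poly (M $ i $ j) z"
  by (simp add: eval_mat_def)

lemma det_eval_mat: "det (eval_mat M z) = poly (det M) z"
  by (simp add: det_def poly_sum poly_prod)

lemma continuous_on_det:
  fixes f :: "'a::topological_space \<Rightarrow> complex^'m^'m"
  assumes "continuous_on S f"
  shows "continuous_on S (\<lambda>x. det (f x))"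
  unfolding det_def by (intro continuous_intros continuous_on_component assms)

text \<open>The rows get degree bounds of their own because the induction for the normal form lowers the
  degree of one row at a time.\<close>
definition row_bounded :: "('m \<Rightarrow> nat) \<Rightarrow> complex poly^'m^'m \<Rightarrow> bool" where
  "row_bounded d M \<longleftrightarrow> (\<forall>i j. degree (M $ i $ j) \<le> d i)"

lemma row_boundedD: "row_bounded d M \<Longrightarrow> degree (M $ i $ j) \<le> d i"
  by (simp add: row_bounded_def)

text \<open>A property of functions, not of polynomials, so that it can restrict the stages of a homotopy;
  only the values on the circle count.\<close>
definition regular :: "('m \<Rightarrow> nat) \<Rightarrow> (complex \<Rightarrow> complex^'m^'m) \<Rightarrow> bool" where
  "regular d f \<longleftrightarrow> (\<exists>M. row_bounded d M \<and> (\<forall>z\<in>circle. f z = eval_mat M z)) \<and> (\<forall>z\<in>circle. det (f z) \<noteq> 0)"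

abbreviation deformable :: "('m \<Rightarrow> nat) \<Rightarrow> (complex \<Rightarrow> complex^'m^'m) \<Rightarrow> (complex \<Rightarrow> complex^'m^'m) \<Rightarrow> bool" where
  "deformable d \<equiv> homotopic_with_canon (regular d) circle UNIV"

lemma regular_eval_mat: "row_bounded d M \<Longrightarrow> (\<And>z. z \<in> circle \<Longrightarrow> det (eval_mat M z) \<noteq> 0) \<Longrightarrow> regular d (eval_mat M)"
  unfolding regular_def by blast

lemma regular_mono: "regular d f \<Longrightarrow> (\<And>i. d i \<le> e i) \<Longrightarrow> regular e f"
  unfolding regular_def row_bounded_def by (meson le_trans)

lemma regular_cong: "(\<And>z. z \<in> circle \<Longrightarrow> f z = g z) \<Longrightarrow> regular d f \<longleftrightarrow> regular d g"
  unfolding regular_def by simp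

lemma eval_mat_continuous: "continuous_on S (eval_mat M)"
  by (simp add: eval_mat_def map_matrix_def) (intro continuous_intros continuous_on_poly)

lemma regular_imp_continuous:
  assumes "regular d f" shows "continuous_on circle f"
proof -
  obtain M where "\<And>z. z \<in> circle \<Longrightarrow> f z = eval_mat M z"
    using assms by (auto simp: regular_def)
  then show ?thesis
    using continuous_on_cong[of circle circle f "eval_mat M"] eval_mat_continuous by blast
qed

lemma deformable_refl: "regular d f \<Longrightarrow> deformable d f f"
  by (simp add: regular_imp_continuous)

lemma deformable_mono:
  assumes "deformable d f g" and "\<And>i. d i \<le> e i"
  shows "deformable e f g"
  using assms(1) by (rule homotopic_with_mono) (rule regular_mono[OF _ assms(2)])

lemma deformable_iff:
  "deformable d f g \<longleftrightarrow> (\<exists>h. continuous_on ({0..1::real} \<times> circle) h \<and> (\<forall>z\<in>circle. h (0, z) = f z) \<and>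
     (\<forall>z\<in>circle. h (1, z) = g z) \<and> (\<forall>t\<in>{0..1}. regular d (\<lambda>z. h (t, z))))"
proof (subst homotopic_with)
  show "regular d h \<longleftrightarrow> regular d k" if "\<And>z. z \<in> topspace (top_of_set circle) \<Longrightarrow> h z = k z" for h k
    using that by (intro regular_cong) simp
qed simp

lemma deformableI:
  assumes "continuous_on ({0..1::real} \<times> circle) (\<lambda>(t, z). h t z)" "\<And>t. t \<in> {0..1} \<Longrightarrow> regular d (h t)"
     "\<And>z. z \<in> circle \<Longrightarrow> h 0 z = f z" "\<And>z. z \<in> circle \<Longrightarrow> h 1 z = g z"
  shows "deformable d f g"
  unfolding deformable_iff using assms by (intro exI[of _ "\<lambda>(t, z). h t z"]) auto

lemma deformable_cong:
  assumes "deformable d f g" "\<And>z. z \<in> circle \<Longrightarrow> f z = f' z" "\<And>z. z \<in> circle \<Longrightarrow> g z = g' z"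
  shows "deformable d f' g'"
proof (rule homotopic_with_eq[OF assms(1)])
  show "regular d h \<longleftrightarrow> regular d k" if "\<And>z. z \<in> topspace (top_of_set circle) \<Longrightarrow> h z = k z" for h k
    using that by (intro regular_cong) simp
qed (simp_all add: assms(2,3))

definition scale_row :: "'m \<Rightarrow> 'a::times \<Rightarrow> 'a^'m^'m \<Rightarrow> 'a^'m^'m" where
  "scale_row i c A = (\<chi> k. if k = i then c *s A $ k else A $ k)"

lemma scale_row_nth: "scale_row i c A $ k $ j = (if k = i then c * A $ k $ j else A $ k $ j)"
  by (simp add: scale_row_def)

lemma det_scale_row: "det (scale_row i c A) = c * det (A :: 'a::comm_ring_1^'m^'m)"
proof -
  have "(\<chi> k. if k = i then A $ k else A $ k) = A"
    by (simp add: vec_eq_iff)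
  then show ?thesis
    using det_row_mul[of i c "\<lambda>k. A $ k" "\<lambda>k. A $ k"] by (simp add: scale_row_def)
qed

lemma regular_scale_row:
  assumes "regular d f" and "\<And>z. z \<in> circle \<Longrightarrow> poly p z \<noteq> 0" and "degree p + d i \<le> e i"
    and "\<And>k. k \<noteq> i \<Longrightarrow> d k \<le> e k"
  shows "regular e (\<lambda>z. scale_row i (poly p z) (f z))"
proof -
  obtain M where M: "row_bounded d M" "\<And>z. z \<in> circle \<Longrightarrow> f z = eval_mat M z"
    using assms(1) by (auto simp: regular_def)
  have "degree (p * M $ i $ j) \<le> e i" for j
    using degree_mult_le[of p "M $ i $ j"] row_boundedD[OF M(1), of i j] assms(3) by linarith
  then have "row_bounded e (scale_row i p M)"
    using le_trans[OF row_boundedD[OF M(1)] assms(4)] by (auto simp: row_bounded_def scale_row_nth)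
  moreover have "scale_row i (poly p z) (f z) = eval_mat (scale_row i p M) z" if "z \<in> circle" for z
    using M(2)[OF that] by (simp add: vec_eq_iff scale_row_nth)
  moreover have "det (scale_row i (poly p z) (f z)) \<noteq> 0" if "z \<in> circle" for z
    using assms(1,2) that by (auto simp: regular_def det_scale_row)
  ultimately show ?thesis
    unfolding regular_def by blast
qed

lemma scale_row_continuous:
  assumes "continuous_on S c" "continuous_on S f"
  shows "continuous_on S (\<lambda>x. scale_row i (c x) (f x :: complex^'m^'m))"
proof -
  have "continuous_on S (\<lambda>x. \<chi> k j. if k = i then c x * f x $ k $ j else f x $ k $ j)"
  proof (intro continuous_on_vec_lambda)
    fix k j
    show "continuous_on S (\<lambda>x. if k = i then c x * f x $ k $ j else f x $ k $ j)"
      by (cases "k = i") (auto intro!: continuous_intros continuous_on_component assms)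
  qed
  moreover have "scale_row i (c x) (f x) = (\<chi> k j. if k = i then c x * f x $ k $ j else f x $ k $ j)" for x
    by (simp add: vec_eq_iff scale_row_nth)
  ultimately show ?thesis by simp
qed

lemma deformable_scale_row:
  assumes fg: "deformable d f g" and p: "\<And>z. z \<in> circle \<Longrightarrow> poly p z \<noteq> 0" and "degree p + d i \<le> e i"
    and "\<And>k. k \<noteq> i \<Longrightarrow> d k \<le> e k"
  shows "deformable e (\<lambda>z. scale_row i (poly p z) (f z)) (\<lambda>z. scale_row i (poly p z) (g z))"
proof -
  obtain h where h: "continuous_on ({0..1::real} \<times> circle) h" "\<forall>z\<in>circle. h (0, z) = f z"
     "\<forall>z\<in>circle. h (1, z) = g z" "\<forall>t\<in>{0..1}. regular d (\<lambda>z. h (t, z))"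
    using fg unfolding deformable_iff by blast
  show ?thesis
  proof (rule deformableI[of "\<lambda>t z. scale_row i (poly p z) (h (t, z))"])
    have "continuous_on ({0..1} \<times> circle) (\<lambda>x. scale_row i (poly p (snd x)) (h x))"
      by (intro scale_row_continuous h(1) continuous_on_poly continuous_on_snd continuous_on_id)
    then show "continuous_on ({0..1} \<times> circle) (\<lambda>(t, z). scale_row i (poly p z) (h (t, z)))"
      by (simp add: case_prod_unfold)
    show "regular e (\<lambda>z. scale_row i (poly p z) (h (t, z)))" if "t \<in> {0..1}" for t
      by (rule regular_scale_row[OF bspec[OF h(4) that]]) (use assms in auto)
  qed (simp_all add: h)
qed

text \<open>A root of the determinant that occurs as a linear factor of one row may be moved along any path
  in the Riemann sphere that avoids the circle. The factor is written $a + bz$ with both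
  coefficients variable, so that the path may end at infinity.\<close>
lemma deformable_linear_factor:
  assumes f: "regular d f" and "continuous_on {0..1::real} a" "continuous_on {0..1} b"
    and nz: "\<And>t z. t \<in> {0..1} \<Longrightarrow> z \<in> circle \<Longrightarrow> poly [:a t, b t:] z \<noteq> 0"
  shows "deformable (d(i := Suc (d i))) (\<lambda>z. scale_row i (poly [:a 0, b 0:] z) (f z))
     (\<lambda>z. scale_row i (poly [:a 1, b 1:] z) (f z))"
proof (rule deformableI[of "\<lambda>t z. scale_row i (poly [:a t, b t:] z) (f z)"])
  have "continuous_on ({0..1} \<times> circle) (\<lambda>x. a (fst x) + b (fst x) * snd x)"
    by (intro continuous_intros continuous_on_compose2[OF assms(2)] continuous_on_compose2[OF assms(3)]) auto
  moreover have "continuous_on ({0..1::real} \<times> circle) (\<lambda>x. f (snd x))"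
    by (rule continuous_on_compose2[OF regular_imp_continuous[OF f]]) (auto intro!: continuous_intros)
  ultimately show "continuous_on ({0..1} \<times> circle) (\<lambda>(t, z). scale_row i (poly [:a t, b t:] z) (f z))"
    using scale_row_continuous[of "{0..1::real} \<times> circle" "\<lambda>x. a (fst x) + b (fst x) * snd x" "\<lambda>x. f (snd x)" i]
    by (simp add: case_prod_unfold mult.commute)
  show "regular (d(i := Suc (d i))) (\<lambda>z. scale_row i (poly [:a t, b t:] z) (f z))" if "t \<in> {0..1}" for t
    by (intro regular_scale_row[OF f nz] that) auto
qed simp_all

section \<open>Row operations\<close>

text \<open>On the complex line through \<open>K\<close> and the identity the determinant is a polynomial that is not
  zero, so singular matrices occur at finitely many parameters only, and the complement of a finite
  set in the plane is path connected.\<close>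
lemma path_to_identity_in_GL:
  fixes K :: "complex^'m^'m"
  assumes "det K \<noteq> 0"
  obtains \<gamma> where "path \<gamma>" "pathstart \<gamma> = K" "pathfinish \<gamma> = mat 1" "\<And>t. t \<in> {0..1} \<Longrightarrow> det (\<gamma> t) \<noteq> 0"
proof -
  define M :: "complex poly^'m^'m" where "M = (\<chi> i j. [:K $ i $ j, mat 1 $ i $ j - K $ i $ j:])"
  define Z where "Z = {s. poly (det M) s = 0}"
  have M: "eval_mat M s = (\<chi> i j. K $ i $ j + s * (mat 1 $ i $ j - K $ i $ j))" for s
    by (simp add: vec_eq_iff M_def)
  have M0: "eval_mat M 0 = K" and M1: "eval_mat M 1 = mat 1"
    by (simp_all add: M vec_eq_iff)
  have "poly (det M) 0 \<noteq> 0"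
    using assms by (metis M0 det_eval_mat)
  then have "det M \<noteq> 0" by force
  then have "finite Z"
    unfolding Z_def by (rule poly_roots_finite)
  then have "path_connected (- Z)"
    by (intro path_connected_complement_countable countable_finite) auto
  moreover have "0 \<in> - Z" "1 \<in> - Z"
    unfolding Z_def using assms M0 M1 by (auto simp: det_eval_mat[symmetric])
  ultimately obtain p where p: "path p" "path_image p \<subseteq> - Z" "pathstart p = 0" "pathfinish p = 1"
    unfolding path_connected_def by blast
  show ?thesis
  proof
    show "path (eval_mat M \<circ> p)"
      using p(1) by (intro path_continuous_image eval_mat_continuous)
    show "pathstart (eval_mat M \<circ> p) = K" "pathfinish (eval_mat M \<circ> p) = mat 1"
      using p M0 M1 by (simp_all add: pathstart_compose pathfinish_compose)
    show "det ((eval_mat M \<circ> p) t) \<noteq> 0" if "t \<in> {0..1}" for t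
    proof -
      have "p t \<in> - Z"
        using p(2) imageI[OF that, of p] unfolding path_image_def by (rule subsetD)
      then show ?thesis
        by (simp add: det_eval_mat Z_def)
    qed
  qed
qed

lemma left_kernel_vector:
  fixes A :: "'a::field^'m^'m"
  assumes "det A = 0"
  obtains v where "v \<noteq> 0" "\<And>k. (\<Sum>j\<in>UNIV. v $ j * A $ j $ k) = 0"
proof -
  have "\<not> invertible (transpose A)"
    by (simp add: invertible_det_nz assms)
  then have "\<not> (\<forall>v. transpose A *v v = 0 \<longrightarrow> v = 0)"
    unfolding invertible_left_inverse matrix_left_invertible_ker .
  then obtain v where v: "transpose A *v v = 0" "v \<noteq> 0"
    by blast
  have "(\<Sum>j\<in>UNIV. v $ j * A $ j $ k) = (transpose A *v v) $ k" for k
    by (simp add: matrix_vector_mult_def transpose_def mult.commute)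
  then show ?thesis
    using v that[of v] by simp
qed

definition combine_rows :: "'m \<Rightarrow> ('m \<Rightarrow> 'a) \<Rightarrow> 'a::comm_ring_1^'m^'m \<Rightarrow> 'a^'m^'m" where
  "combine_rows i q A = (\<chi> k. if k = i then (\<Sum>j\<in>UNIV. q j *s A $ j) else A $ k)"

lemma combine_rows_nth:
  "combine_rows i q A $ k $ l = (if k = i then (\<Sum>j\<in>UNIV. q j * A $ j $ l) else A $ k $ l)"
  by (simp add: combine_rows_def sum_component)

lemma det_combine_rows:
  fixes A :: "'a::field^'m^'m"
  shows "det (combine_rows i q A) = q i * det A"
proof -
  have "row j A = A $ j" for j
    by (simp add: row_def)
  then show ?thesis
    using cramer_lemma_transpose[of i "vec_lambda q" A] by (simp add: combine_rows_def cong: if_cong)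
qed

lemma eval_mat_combine_rows:
  "eval_mat (combine_rows i q M) z = combine_rows i (\<lambda>j. poly (q j) z) (eval_mat M z)"
  by (simp add: vec_eq_iff combine_rows_nth poly_sum)

lemma row_bounded_combine_rows:
  assumes M: "row_bounded d M" and q: "\<And>j. q j = 0 \<or> degree (q j) + d j \<le> d i"
  shows "row_bounded d (combine_rows i q M)"
proof -
  have "degree (q j * M $ j $ l) \<le> d i" for j l
    using q[of j] degree_mult_le[of "q j" "M $ j $ l"] row_boundedD[OF M, of j l] by auto
  then show ?thesis
    using M by (auto simp: row_bounded_def combine_rows_nth intro!: degree_sum_le)
qed

text \<open>A row operation that does not rescale the row \<open>i\<close> keeps the determinant. Hence all other
  multipliers can be switched on linearly.\<close>
lemma deformable_combine_rows:
  assumes M: "row_bounded d M" and nz: "\<And>z. z \<in> circle \<Longrightarrow> det (eval_mat M z) \<noteq> 0"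
    and q: "q i = 1" "\<And>j. q j = 0 \<or> degree (q j) + d j \<le> d i"
  shows "deformable d (eval_mat M) (eval_mat (combine_rows i q M))"
proof -
  define r where "r t j = (if j = i then 1 else smult (of_real t) (q j))" for t :: real and j
  have entry: "eval_mat (combine_rows i (r t) M) z $ k $ l =
      (if k = i then (\<Sum>j\<in>UNIV. (if j = i then 1 else of_real t * poly (q j) z) * poly (M $ j $ l) z)
        else poly (M $ k $ l) z)" for t z k l
    by (auto simp: combine_rows_nth poly_sum r_def intro!: sum.cong)
  show ?thesis
  proof (rule deformableI[of "\<lambda>t. eval_mat (combine_rows i (r t) M)"])
  have "continuous_on ({0..1} \<times> circle) (\<lambda>x. if j = i then 1 else of_real (fst x) * poly (q j) (snd x))" for j
    by (cases "j = i") (auto intro!: continuous_intros continuous_on_poly)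
  then have "continuous_on ({0..1} \<times> circle) (\<lambda>(t, z). eval_mat (combine_rows i (r t) M) z $ k $ l)" for k l
    unfolding entry case_prod_unfold
    by (cases "k = i") (auto intro!: continuous_on_sum continuous_on_mult continuous_on_poly continuous_on_snd continuous_on_id)
  then have "continuous_on ({0..1} \<times> circle) (\<lambda>(t, z). \<chi> k l. eval_mat (combine_rows i (r t) M) z $ k $ l)"
    unfolding case_prod_unfold by (intro continuous_on_vec_lambda)
  then show "continuous_on ({0..1} \<times> circle) (\<lambda>(t, z). eval_mat (combine_rows i (r t) M) z)"
    by (simp only: vec_nth_inverse)
  show "regular d (eval_mat (combine_rows i (r t) M))" for t
  proof (rule regular_eval_mat)
    show "row_bounded d (combine_rows i (r t) M)"
      using q degree_smult_le by (intro row_bounded_combine_rows M) (auto simp: r_def)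
    show "det (eval_mat (combine_rows i (r t) M) z) \<noteq> 0" if "z \<in> circle" for z
      using nz[OF that] by (simp add: eval_mat_combine_rows det_combine_rows r_def)
  qed
  show "eval_mat (combine_rows i (r 0) M) z = eval_mat M z" for z
    unfolding vec_eq_iff entry by (auto simp: sum.delta if_distrib[of "\<lambda>x. x * _"] cong: if_cong)
  have "r 1 = q"
    using q(1) by (auto simp: r_def fun_eq_iff)
  then show "eval_mat (combine_rows i (r 1) M) z = eval_mat (combine_rows i q M) z" for z
    by simp
  qed
qed

lemma coeff_mult_at_degree_bounds:
  fixes p q :: "'a::comm_semiring_0 poly"
  assumes "degree p \<le> a" "degree q \<le> b"
  shows "coeff (p * q) (a + b) = coeff p a * coeff q b"
proof -
  have "coeff (p * q) (a + b) = (\<Sum>i\<le>a + b. if i = a then coeff p a * coeff q b else 0)"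
    unfolding coeff_mult
  proof (intro sum.cong refl)
    fix i assume "i \<in> {..a + b}"
    moreover have "coeff p i = 0" if "i > a" using that assms(1) by (simp add: coeff_eq_0)
    moreover have "coeff q (a + b - i) = 0" if "i < a" using that assms(2) by (simp add: coeff_eq_0)
    ultimately show "coeff p i * coeff q (a + b - i) = (if i = a then coeff p a * coeff q b else 0)"
      by (cases i a rule: linorder_cases) auto
  qed
  then show ?thesis by simp
qed

lemma coeff_prod_at_degree_bounds:
  fixes p :: "'i \<Rightarrow> 'a::comm_semiring_1 poly"
  assumes "finite I" "\<And>i. i \<in> I \<Longrightarrow> degree (p i) \<le> d i"
  shows "coeff (\<Prod>i\<in>I. p i) (\<Sum>i\<in>I. d i) = (\<Prod>i\<in>I. coeff (p i) (d i)) \<and> degree (\<Prod>i\<in>I. p i) \<le> (\<Sum>i\<in>I. d i)"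
  using assms
proof (induction I)
  case (insert i I)
  moreover from this have "degree (p i * prod p I) \<le> d i + sum d I"
    by (intro order_trans[OF degree_mult_le] add_mono) auto
  ultimately show ?case
    by (auto simp: coeff_mult_at_degree_bounds)
qed auto

text \<open>The coefficient of the determinant at the largest conceivable degree is itself a determinant, and
  it decides whether that degree is attained.\<close>
lemma coeff_det_row_bounded:
  assumes "row_bounded d M"
  shows "coeff (det M) (\<Sum>i\<in>UNIV. d i) = det (\<chi> i j. coeff (M $ i $ j) (d i))"
proof -
  have "coeff (of_int (sign \<pi>) * (\<Prod>i\<in>UNIV. M $ i $ \<pi> i)) (\<Sum>i\<in>UNIV. d i)
      = of_int (sign \<pi>) * (\<Prod>i\<in>UNIV. coeff (M $ i $ \<pi> i) (d i))" for \<pi> :: "'a \<Rightarrow> 'a"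
    using coeff_prod_at_degree_bounds[of UNIV "\<lambda>i. M $ i $ \<pi> i" d] assms
    by (simp add: row_bounded_def of_int_poly)
  then show ?thesis
    by (simp add: det_def coeff_sum)
qed

section \<open>Lowering the degree of a row\<close>

text \<open>Row operations must not exceed the degree bound of the row that they change. So in a linear
  dependency between rows one changes the row with the largest bound among those that occur.\<close>
lemma support_index_of_maximal_degree:
  fixes v :: "complex^'m" and d :: "'m \<Rightarrow> nat"
  assumes "v \<noteq> 0"
  obtains i where "v $ i \<noteq> 0" "\<And>j. v $ j \<noteq> 0 \<Longrightarrow> d j \<le> d i"
proof -
  have "\<exists>j. v $ j \<noteq> 0"
    using assms by (simp add: vec_eq_iff)
  then have ne: "{j. v $ j \<noteq> 0} \<noteq> {}" by blast
  then have "Max (d ` {j. v $ j \<noteq> 0}) \<in> d ` {j. v $ j \<noteq> 0}"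
    by (intro Max_in) auto
  then obtain i where i: "v $ i \<noteq> 0" "Max (d ` {j. v $ j \<noteq> 0}) = d i"
    by auto
  show ?thesis
  proof
    show "v $ i \<noteq> 0" by (fact i)
    show "d j \<le> d i" if "v $ j \<noteq> 0" for j
      unfolding i(2)[symmetric] using that by (intro Max_ge) auto
  qed
qed

text \<open>A dependency between the vectors of extreme coefficients becomes, after the rows are shifted by
  powers of $z$ to a common degree, a row operation that cancels the extreme coefficient of a row.\<close>
lemma lower_row_degree:
  assumes M: "row_bounded d M" and nz: "\<And>z. z \<in> circle \<Longrightarrow> det (eval_mat M z) \<noteq> 0"
    and sing: "det (\<chi> i j. coeff (M $ i $ j) (d i)) = 0"
  obtains i B where "d i > 0" "regular (d(i := d i - 1)) B" "deformable d (eval_mat M) B"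
proof -
  obtain v where v: "v \<noteq> 0" "\<And>k. (\<Sum>j\<in>UNIV. v $ j * coeff (M $ j $ k) (d j)) = 0"
    using left_kernel_vector[OF sing] by auto
  obtain i where i: "v $ i \<noteq> 0" "\<And>j. v $ j \<noteq> 0 \<Longrightarrow> d j \<le> d i"
    using support_index_of_maximal_degree[OF v(1)] by metis
  define q where "q j = monom (v $ j / v $ i) (d i - d j)" for j
  define M' where "M' = combine_rows i q M"
  have qi: "q i = 1"
    using i by (simp add: q_def)
  have q: "q j = 0 \<or> degree (q j) + d j \<le> d i" for j
 proof (cases "v $ j = 0")
    case False
    then show ?thesis
      using i(2)[of j] degree_monom_le[of "v $ j / v $ i" "d i - d j"] unfolding q_def by linarith
  qed (simp add: q_def)
  have M': "row_bounded d M'"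
    unfolding M'_def by (rule row_bounded_combine_rows[OF M q])
  have det: "det (eval_mat M' z) \<noteq> 0" if "z \<in> circle" for z
    using nz[OF that] by (simp add: M'_def eval_mat_combine_rows det_combine_rows qi)
  have "coeff (q j * M $ j $ k) (d i) = v $ j * coeff (M $ j $ k) (d j) / v $ i" for j k
    using i(2)[of j] by (cases "v $ j = 0") (auto simp: q_def coeff_monom_mult)
  then have top: "coeff (M' $ i $ k) (d i) = 0" for k
    by (simp add: M'_def combine_rows_nth coeff_sum v(2) flip: sum_divide_distrib)
  \<comment> \<open>A row of degree bound 0 would be cancelled altogether, against invertibility on the circle.\<close>
  have "d i > 0"
  proof (rule ccontr)
    assume "\<not> d i > 0"
    then have "M' $ i $ k = 0" for k
      using top[of k] row_boundedD[OF M', of i k] by (metis bot_nat_0.not_eq_extremum le_zero_eq leading_coeff_0_iff)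
    then have "row i (eval_mat M' 1) = 0"
      by (simp add: row_def vec_eq_iff)
    then show False
      using det[of 1] det_zero_row(2) by auto
  qed
  moreover have "row_bounded (d(i := d i - 1)) M'"
  proof -
    have "degree (M' $ i $ k) \<le> d i - 1" for k
      using top[of k] row_boundedD[OF M', of i k] \<open>d i > 0\<close>
      by (metis One_nat_def Suc_pred coeff_0 degree_0 le_SucE le_zero_eq leading_coeff_0_iff zero_le)
    then show ?thesis
      using M' by (auto simp: row_bounded_def)
  qed
  moreover have "deformable d (eval_mat M) (eval_mat M')"
    unfolding M'_def by (rule deformable_combine_rows[OF M nz qi q])
  ultimately show ?thesis
    using that regular_eval_mat[OF _ det] by blast
qed

text \<open>A dependency between the rows of the singular matrix at \<open>w\<close> is a row operation, with
  constant multipliers, after which a row vanishes at \<open>w\<close>.\<close>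
lemma split_off_root:
  assumes M: "row_bounded d M" and nz: "\<And>z. z \<in> circle \<Longrightarrow> det (eval_mat M z) \<noteq> 0"
    and root: "det (eval_mat M w) = 0"
  obtains i B where "d i > 0" "regular (d(i := d i - 1)) B"
    "deformable d (eval_mat M) (\<lambda>z. scale_row i (z - w) (B z))"
proof -
  obtain v where v: "v \<noteq> 0" "\<And>k. (\<Sum>j\<in>UNIV. v $ j * poly (M $ j $ k) w) = 0"
    using left_kernel_vector[OF root] by auto
  obtain i where i: "v $ i \<noteq> 0" "\<And>j. v $ j \<noteq> 0 \<Longrightarrow> d j \<le> d i"
    using support_index_of_maximal_degree[OF v(1)] by metis
  define q where "q j = [:v $ j / v $ i:]" for j
  define M' where "M' = combine_rows i q M"
  have qi: "q i = 1"
    using i by (simp add: q_def one_pCons)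
  have q: "q j = 0 \<or> degree (q j) + d j \<le> d i" for j
    using i(2)[of j] by (auto simp: q_def)
  have M': "row_bounded d M'"
    unfolding M'_def by (rule row_bounded_combine_rows[OF M q])
  have det: "det (eval_mat M' z) \<noteq> 0" if "z \<in> circle" for z
    using nz[OF that] by (simp add: M'_def eval_mat_combine_rows det_combine_rows qi)
  have "poly (M' $ i $ k) w = (\<Sum>j\<in>UNIV. v $ j * poly (M $ j $ k) w / v $ i)" for k
    by (simp add: M'_def combine_rows_nth poly_sum q_def)
  then have "poly (M' $ i $ k) w = 0" for k
    by (simp add: v(2) flip: sum_divide_distrib)
  then have "\<forall>k. \<exists>s. M' $ i $ k = [:- w, 1:] * s"
    by (simp add: poly_eq_0_iff_dvd dvd_def)
  then obtain s where s: "\<And>k. M' $ i $ k = [:- w, 1:] * s k"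
    by metis
  define B where "B = (\<chi> k l. if k = i then s l else M' $ k $ l)"
  have scale: "eval_mat M' z = scale_row i (z - w) (eval_mat B z)" for z
    by (simp add: vec_eq_iff scale_row_nth B_def s algebra_simps)
  have detB: "det (eval_mat B z) \<noteq> 0" if "z \<in> circle" for z
    using det[OF that] by (auto simp: scale det_scale_row)
  have deg: "s k = 0 \<or> Suc (degree (s k)) \<le> d i" for k
    using row_boundedD[OF M', of i k] by (cases "s k = 0") (auto simp: s degree_mult_eq simp del: mult_pCons_left)
  have "d i > 0"
  proof (rule ccontr)
    assume "\<not> d i > 0"
    then have "s k = 0" for k using deg[of k] by auto
    then have "row i (eval_mat B 1) = 0"
      by (simp add: row_def vec_eq_iff B_def)
    then show False
      using detB[of 1] det_zero_row(2) by auto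
  qed
  moreover have "row_bounded (d(i := d i - 1)) B"
  proof -
    have "degree (s k) \<le> d i - 1" for k
      using deg[of k] by auto
    then show ?thesis
      using M' by (auto simp: row_bounded_def B_def)
  qed
  moreover have "deformable d (eval_mat M) (\<lambda>z. scale_row i (z - w) (eval_mat B z))"
    unfolding scale[symmetric] M'_def by (rule deformable_combine_rows[OF M nz qi q])
  ultimately show ?thesis
    using that regular_eval_mat[OF _ detB] by blast
qed

text \<open>The disjunction in the conclusion records where a root of the determinant went: to infinity,
  where it disappears, or to $0$, where it leaves the factor $z$.\<close>
lemma reduce_degree:
  assumes f: "regular d f" and pos: "(\<Sum>i\<in>UNIV. d i) > 0"
  obtains i B where "d i > 0" "regular (d(i := d i - 1)) B"
    "deformable d f B \<or> deformable d f (\<lambda>z. scale_row i z (B z))"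
proof -
  obtain M where M: "row_bounded d M" and fM: "\<And>z. z \<in> circle \<Longrightarrow> f z = eval_mat M z"
    and nz: "\<And>z. z \<in> circle \<Longrightarrow> det (eval_mat M z) \<noteq> 0"
    using f by (fastforce simp: regular_def)
  have "deformable d (eval_mat M) (eval_mat M)"
    by (intro deformable_refl regular_eval_mat M nz)
  then have f_M: "deformable d f (eval_mat M)"
    by (rule deformable_cong) (simp_all add: fM)
  show ?thesis
  proof (cases "det (\<chi> i j. coeff (M $ i $ j) (d i)) = 0")
    case True
    obtain i B where "d i > 0" "regular (d(i := d i - 1)) B" "deformable d (eval_mat M) B"
      using lower_row_degree[OF M nz True] .
    then show ?thesis
      using that homotopic_with_trans[OF f_M] by blast
  next
    case False
    then have "coeff (det M) (\<Sum>i\<in>UNIV. d i) \<noteq> 0"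
      by (simp add: coeff_det_row_bounded[OF M])
    then have "(\<Sum>i\<in>UNIV. d i) \<le> degree (det M)"
      by (rule le_degree)
    then obtain w where "poly (det M) w = 0"
      using pos alg_closed_imp_poly_has_root[of "det M"] by auto
    then have root: "det (eval_mat M w) = 0"
      by (simp add: det_eval_mat)
    then have w: "norm w \<noteq> 1"
      using nz[of w] by auto
    obtain i B where i: "d i > 0" and B: "regular (d(i := d i - 1)) B"
      and M_B: "deformable d (eval_mat M) (\<lambda>z. scale_row i (z - w) (B z))"
      using split_off_root[OF M nz root] .
    have d: "(d(i := d i - 1))(i := Suc ((d(i := d i - 1)) i)) = d"
      using i by auto
    show ?thesis
    proof (cases "norm w < 1")
      case True
      \<comment> \<open>The root inside the circle moves along the segment from \<open>w\<close> to 0.\<close>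
      have "deformable d (\<lambda>z. scale_row i (poly [:- (1 - complex_of_real 0) * w, 1:] z) (B z))
              (\<lambda>z. scale_row i (poly [:- (1 - complex_of_real 1) * w, 1:] z) (B z))"
      proof (rule deformable_linear_factor[OF B, of "\<lambda>t. - (1 - of_real t) * w" "\<lambda>t. 1" i, unfolded d])
        fix t :: real and z :: complex
        assume t: "t \<in> {0..1}" and z: "z \<in> circle"
        have "norm ((1 - of_real t) * w) = norm (complex_of_real (1 - t)) * norm w"
          by (simp add: norm_mult)
        also have "\<dots> = (1 - t) * norm w"
          using t by (subst norm_of_real) simp
        also have "\<dots> \<le> 1 * norm w"
          using t by (intro mult_right_mono) auto
        finally have "(1 - of_real t) * w \<noteq> z"
          using True z by auto
        moreover have "poly [:- (1 - of_real t) * w, 1:] z = z - (1 - of_real t) * w"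
          by (simp add: algebra_simps)
        ultimately show "poly [:- (1 - of_real t) * w, 1:] z \<noteq> 0"
          by simp
      qed (auto intro!: continuous_intros)
      then have "deformable d (\<lambda>z. scale_row i (z - w) (B z)) (\<lambda>z. scale_row i z (B z))"
        by simp
      from homotopic_with_trans[OF f_M homotopic_with_trans[OF M_B this]] show ?thesis
        using that[OF i B] by blast
    next
      case False
      \<comment> \<open>The root outside the circle moves along the ray from \<open>w\<close> to infinity.\<close>
      have "deformable d (\<lambda>z. scale_row i (poly [:- w, 1 - complex_of_real 0:] z) (B z))
              (\<lambda>z. scale_row i (poly [:- w, 1 - complex_of_real 1:] z) (B z))"
      proof (rule deformable_linear_factor[OF B, of "\<lambda>t. - w" "\<lambda>t. 1 - of_real t" i, unfolded d])
        fix t :: real and z :: complex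
        assume t: "t \<in> {0..1}" and z: "z \<in> circle"
        have "norm (z * (1 - of_real t)) = norm (complex_of_real (1 - t))"
          using z by (simp add: norm_mult)
        also have "\<dots> = 1 - t"
          using t by (subst norm_of_real) simp
        finally show "poly [:- w, 1 - of_real t:] z \<noteq> 0"
          using False w t by auto
      qed (auto intro!: continuous_intros)
      then have "deformable d (\<lambda>z. scale_row i (z - w) (B z)) (\<lambda>z. scale_row i (- w) (B z))"
        by simp
      from homotopic_with_trans[OF f_M homotopic_with_trans[OF M_B this]]
      have "deformable d f (\<lambda>z. scale_row i (- w) (B z))" .
      moreover have "regular (d(i := d i - 1)) (\<lambda>z. scale_row i (poly [:- w:] z) (B z))"
        using False by (intro regular_scale_row[OF B]) auto
      ultimately show ?thesis
        using that[OF i, of "\<lambda>z. scale_row i (- w) (B z)"] by simp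
    qed
  qed
qed

section \<open>The diagonal normal form\<close>

definition diag_powers :: "('m \<Rightarrow> nat) \<Rightarrow> complex \<Rightarrow> complex^'m^'m" where
  "diag_powers c z = (\<chi> i j. if i = j then z ^ c i else 0)"

lemma det_diag_powers: "det (diag_powers c z) = z ^ (\<Sum>i\<in>UNIV. c i)"
  by (subst det_diagonal) (auto simp: diag_powers_def power_sum)

lemma regular_diag_powers:
  assumes "\<And>i. c i \<le> d i"
  shows "regular d (diag_powers c)"
proof -
  have "row_bounded d (\<chi> i j. if i = j then monom 1 (c i) else 0)"
    using assms by (auto simp: row_bounded_def degree_monom_eq)
  moreover have "diag_powers c z = eval_mat (\<chi> i j. if i = j then monom 1 (c i) else 0) z" for z
    by (simp add: diag_powers_def vec_eq_iff poly_monom)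
  moreover have "det (diag_powers c z) \<noteq> 0" if "z \<in> circle" for z
    using that by (auto simp: det_diag_powers)
  ultimately show ?thesis
    unfolding regular_def by blast
qed

text \<open>Induction on the sum of the degree bounds. A factor $z$ left behind by the reduction is put back on
  its row at the end, since it multiplies a diagonal matrix to a diagonal matrix.\<close>
lemma deformable_to_diag_powers:
  assumes "regular d f"
  shows "\<exists>c. (\<forall>i. c i \<le> d i) \<and> deformable d f (diag_powers c)"
  using assms
proof (induction "\<Sum>i\<in>UNIV. d i" arbitrary: d f rule: less_induct)
  case less
  show ?case
  proof (cases "(\<Sum>i\<in>UNIV. d i) = 0")
    case True
    then have d: "d i = 0" for i by simp
    obtain M where M: "row_bounded d M" "\<And>z. z \<in> circle \<Longrightarrow> f z = eval_mat M z"
      and nz: "\<And>z. z \<in> circle \<Longrightarrow> det (f z) \<noteq> 0"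
      using less.prems by (auto simp: regular_def)
    have "degree (M $ i $ j) = 0" for i j
      using row_boundedD[OF M(1), of i j] d by simp
    then have "poly (M $ i $ j) z = poly (M $ i $ j) 1" for i j z
      using degree_eq_zeroE[of "M $ i $ j"] by fastforce
    then have f: "f z = f 1" if "z \<in> circle" for z
      using M(2)[OF that] M(2)[of 1] by (simp add: vec_eq_iff)
    obtain \<gamma> where \<gamma>: "path \<gamma>" "pathstart \<gamma> = f 1" "pathfinish \<gamma> = mat 1"
      "\<And>t. t \<in> {0..1} \<Longrightarrow> det (\<gamma> t) \<noteq> 0"
      using path_to_identity_in_GL[of "f 1"] nz[of 1] by auto
    have "deformable d f (diag_powers (\<lambda>i. 0))"
    proof (rule deformableI[of "\<lambda>t z. \<gamma> t"])
      show "continuous_on ({0..1} \<times> circle) (\<lambda>(t, z::complex). \<gamma> t)"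
        unfolding case_prod_unfold using \<gamma>(1) unfolding path_def
        by (rule continuous_on_compose2) (auto intro!: continuous_intros)
      show "regular d (\<lambda>z. \<gamma> t)" if "t \<in> {0..1}" for t
      proof -
        have "row_bounded d (\<chi> i j. [:\<gamma> t $ i $ j:])"
          by (simp add: row_bounded_def)
        moreover have "\<gamma> t = eval_mat (\<chi> i j. [:\<gamma> t $ i $ j:]) z" for z
          by (simp add: vec_eq_iff)
        ultimately show ?thesis
          unfolding regular_def using \<gamma>(4)[OF that] by blast
      qed
      show "\<gamma> 0 = f z" if "z \<in> circle" for z
        using \<gamma>(2) f[OF that] by (simp add: pathstart_def)
      show "\<gamma> 1 = diag_powers (\<lambda>i. 0) z" for z
        using \<gamma>(3) by (simp add: pathfinish_def diag_powers_def mat_def cong: if_cong)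
    qed
    then show ?thesis by auto
  next
    case False
    then have pos: "(\<Sum>i\<in>UNIV. d i) > 0" by linarith
    obtain i B where i: "d i > 0" and B: "regular (d(i := d i - 1)) B"
      and f: "deformable d f B \<or> deformable d f (\<lambda>z. scale_row i z (B z))"
      using reduce_degree[OF less.prems pos] .
    let ?d = "d(i := d i - 1)"
    have "(\<Sum>k\<in>UNIV. ?d k) < (\<Sum>k\<in>UNIV. d k)"
      using i by (intro sum_strict_mono_ex1) auto
    then obtain c where c: "\<And>k. c k \<le> ?d k" and Bc: "deformable ?d B (diag_powers c)"
      using less.hyps[OF _ B] by blast
    have cd: "c k \<le> d k" for k
      using c[of k] by (cases "k = i") auto
    have ci: "Suc (c i) \<le> d i"
      using c[of i] i by simp
    show ?thesis
      using f
    proof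
      assume f: "deformable d f B"
      have "deformable d B (diag_powers c)"
        by (rule deformable_mono[OF Bc]) auto
      from homotopic_with_trans[OF f this] show ?thesis
        using cd by blast
    next
      assume f: "deformable d f (\<lambda>z. scale_row i z (B z))"
      have "deformable d (\<lambda>z. scale_row i (poly [:0, 1:] z) (B z)) (\<lambda>z. scale_row i (poly [:0, 1:] z) (diag_powers c z))"
        by (rule deformable_scale_row[OF Bc]) (use i in auto)
      moreover have "scale_row i (poly [:0, 1:] z) (diag_powers c z) = diag_powers (c(i := Suc (c i))) z" for z
        by (simp add: vec_eq_iff scale_row_nth diag_powers_def)
      ultimately have "deformable d (\<lambda>z. scale_row i z (B z)) (diag_powers (c(i := Suc (c i))))"
        by simp
      from homotopic_with_trans[OF f this]
      have "deformable d f (diag_powers (c(i := Suc (c i))))" .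
      moreover have "(c(i := Suc (c i))) k \<le> d k" for k
        using cd ci by simp
      ultimately show ?thesis by blast
    qed
  qed
qed

section \<open>Deformations between diagonal matrices\<close>

text \<open>This is $1 + (z-1)uu^T$. For $u^Tu = 1$ it multiplies the direction $u$ by $z$ and
  fixes the orthogonal complement of $u$ for the bilinear form; it interpolates between the diagonal
  matrices with a single entry $z$ when $u$ runs through real unit vectors.\<close>
definition rank_one_twist :: "('m \<Rightarrow> complex) \<Rightarrow> complex \<Rightarrow> complex^'m^'m" where
  "rank_one_twist u z = (\<chi> k l. (if k = l then 1 else 0) + (z - 1) * (u k * u l))"

lemma rank_one_twist_mult:
  assumes "(\<Sum>r\<in>UNIV. u r * u r) = 1"
  shows "rank_one_twist u z ** rank_one_twist u w = rank_one_twist u (z * w)"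
proof -
  have "(\<Sum>r\<in>UNIV. ((if k = r then 1 else 0) + (z - 1) * (u k * u r)) * ((if r = l then 1 else 0) + (w - 1) * (u r * u l)))
    = (if k = l then 1 else 0) + (z * w - 1) * (u k * u l)" for k l
  proof -
    have "(\<Sum>r\<in>UNIV. ((if k = r then 1 else 0) + (z - 1) * (u k * u r)) * ((if r = l then 1 else 0) + (w - 1) * (u r * u l)))
      = (\<Sum>r\<in>UNIV. (if k = r then (if r = l then 1 else 0) + (w - 1) * (u r * u l) else 0)
          + (if r = l then (z - 1) * (u k * u r) else 0)
          + (z - 1) * (w - 1) * u k * u l * (u r * u r))"
      by (intro sum.cong refl) (auto simp: algebra_simps)
    also have "\<dots> = (if k = l then 1 else 0) + (w - 1) * (u k * u l) + (z - 1) * (u k * u l)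
        + (z - 1) * (w - 1) * u k * u l * (\<Sum>r\<in>UNIV. u r * u r)"
      by (simp add: sum.distrib sum_distrib_left)
    also have "\<dots> = (if k = l then 1 else 0) + (z * w - 1) * (u k * u l)"
      by (simp add: assms algebra_simps)
    finally show ?thesis .
  qed
  then show ?thesis
    by (simp add: vec_eq_iff matrix_matrix_mult_def rank_one_twist_def)
qed

text \<open>Only the rows \<open>i\<close> and \<open>j\<close> gain a degree when the twist multiplies from the right by a unit vector
  of their coordinate plane, and both have room for it. At every stage the matrix is invertible away
  from $z = 0$, the inverse of the twist being the twist with $1/z$.\<close>
lemma deformable_diag_powers_swap:
  assumes ij: "i \<noteq> j" and ci: "c i < d i" and cj: "c j < d j" and c: "\<And>k. c k \<le> d k"
  shows "deformable d (diag_powers (c(i := Suc (c i)))) (diag_powers (c(j := Suc (c j))))"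
proof -
  define u :: "real \<Rightarrow> _ \<Rightarrow> complex" where
    "u t k = (if k = i then of_real (cos (t * (pi/2))) else if k = j then of_real (sin (t * (pi/2))) else 0)" for t k
  have unit: "(\<Sum>r\<in>UNIV. u t r * u t r) = 1" for t
  proof -
    have "(\<Sum>r\<in>UNIV. u t r * u t r) = (\<Sum>r\<in>{i, j}. u t r * u t r)"
      by (rule sum.mono_neutral_right) (auto simp: u_def)
    also have "\<dots> = of_real (cos (t * (pi/2))) * of_real (cos (t * (pi/2)))
        + of_real (sin (t * (pi/2))) * of_real (sin (t * (pi/2)))"
      using ij by (simp add: u_def)
    also have "\<dots> = of_real (cos (t * (pi/2)) * cos (t * (pi/2)) + sin (t * (pi/2)) * sin (t * (pi/2)))"
      by (simp only: of_real_add of_real_mult)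
    finally show ?thesis
      by (simp only: sin_cos_squared_add3 of_real_1)
  qed
  define h where "h t z = diag_powers c z ** rank_one_twist (u t) z" for t z
  have entry: "h t z $ k $ l = z ^ c k * ((if k = l then 1 else 0) + (z - 1) * (u t k * u t l))" for t z k l
  proof -
    have "h t z $ k $ l = (\<Sum>r\<in>UNIV. (if k = r then z ^ c k else 0) * rank_one_twist (u t) z $ r $ l)"
      by (simp add: h_def matrix_matrix_mult_def diag_powers_def)
    also have "\<dots> = (\<Sum>r\<in>UNIV. if k = r then z ^ c k * rank_one_twist (u t) z $ r $ l else 0)"
      by (rule sum.cong) auto
    finally show ?thesis
      by (simp add: rank_one_twist_def)
  qed
  have u01: "u 0 k = (if k = i then 1 else 0)" "u 1 k = (if k = j then 1 else 0)" for k
    using ij by (auto simp: u_def)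
  show ?thesis
  proof (rule deformableI[of h])
    have "continuous_on ({0..1} \<times> circle) (\<lambda>x. u (fst x) k)" for k
      by (cases "k = i"; cases "k = j") (auto simp: u_def intro!: continuous_intros)
    then have "continuous_on ({0..1} \<times> circle) (\<lambda>x. \<chi> k l. h (fst x) (snd x) $ k $ l)"
      unfolding entry by (intro continuous_on_vec_lambda continuous_intros)
    then show "continuous_on ({0..1} \<times> circle) (\<lambda>(t, z). h t z)"
      by (simp add: case_prod_unfold)
    show "regular d (h t)" for t
    proof -
      define M where "M = (\<chi> k l. monom 1 (c k) * [:(if k = l then 1 else 0) - u t k * u t l, u t k * u t l:])"
      have "degree (M $ k $ l) \<le> d k" for k l
      proof (cases "k = i \<or> k = j")
        case True
        have "degree (monom 1 (c k) * [:a, b:]) \<le> c k + 1" for a b :: complex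
        proof -
          have "degree [:a, b:] \<le> 1" by simp
          then show ?thesis
            using degree_monom_le[of "1::complex" "c k"] degree_mult_le[of "monom 1 (c k)" "[:a, b:]"] by linarith
        qed
        then have "degree (M $ k $ l) \<le> c k + 1"
          unfolding M_def vec_lambda_beta .
        also have "\<dots> \<le> d k"
          using True ci cj by auto
        finally show ?thesis .
      next
        case False
        then have "M $ k $ l = monom 1 (c k) * [:if k = l then 1 else 0:]"
          by (simp add: M_def u_def)
        also have "degree \<dots> \<le> c k"
          using degree_monom_le[of "1::complex" "c k"] degree_mult_le[of "monom 1 (c k)" "[:if k = l then 1 else 0 :: complex:]"]
          by simp
        finally show ?thesis
          using c le_trans by blast
      qed
      then have "row_bounded d M"
        by (simp add: row_bounded_def)
      moreover have "h t z = eval_mat M z" for z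
        by (simp add: vec_eq_iff entry M_def poly_monom algebra_simps)
      moreover have "det (h t z) \<noteq> 0" if "z \<in> circle" for z
      proof -
        have z: "z \<noteq> 0" using that by auto
        have "rank_one_twist (u t) z ** rank_one_twist (u t) (inverse z) = rank_one_twist (u t) 1"
          using z by (simp add: rank_one_twist_mult[OF unit])
        also have "\<dots> = mat 1"
          by (simp add: rank_one_twist_def mat_def)
        finally have "det (rank_one_twist (u t) z) * det (rank_one_twist (u t) (inverse z)) = 1"
          by (metis det_I det_mul)
        then have "det (rank_one_twist (u t) z) \<noteq> 0" by auto
        then show ?thesis
          using z by (simp add: h_def det_mul det_diag_powers)
      qed
      ultimately show ?thesis
        unfolding regular_def by blast
    qed
    show "h 0 z = diag_powers (c(i := Suc (c i))) z" for z
      by (auto simp: vec_eq_iff entry u01 diag_powers_def)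
    show "h 1 z = diag_powers (c(j := Suc (c j))) z" for z
      by (auto simp: vec_eq_iff entry u01 diag_powers_def)
  qed
qed

text \<open>Single factors $z$ are carried from an exponent that is too large to one that is too small. The sum
  of the excesses drops each time.\<close>
lemma deformable_diag_powers:
  assumes "\<And>i. c i \<le> d i" "\<And>i. c' i \<le> d i" "(\<Sum>i\<in>UNIV. c i) = (\<Sum>i\<in>UNIV. c' i)"
  shows "deformable d (diag_powers c) (diag_powers c')"
  using assms
proof (induction "\<Sum>i\<in>UNIV. c i - c' i" arbitrary: c rule: less_induct)
  case less
  show ?case
  proof (cases "c = c'")
    case True
    then show ?thesis
      using less.prems(1) by (simp only: deformable_refl regular_diag_powers)
  next
    case False
    have "\<exists>i. c' i < c i"
    proof (rule ccontr)
      assume "\<nexists>i. c' i < c i"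
      then have le: "c i \<le> c' i" for i by (simp add: not_less)
      moreover obtain i where "c i \<noteq> c' i" using False by auto
      ultimately have "(\<Sum>i\<in>UNIV. c i) < (\<Sum>i\<in>UNIV. c' i)"
        by (intro sum_strict_mono_ex1) (auto simp: order_less_le)
      then show False using less.prems(3) by simp
    qed
    then obtain i where i: "c' i < c i" by blast
    have "\<exists>j. c j < c' j"
    proof (rule ccontr)
      assume "\<nexists>j. c j < c' j"
      then have le: "c' j \<le> c j" for j by (simp add: not_less)
      then have "(\<Sum>i\<in>UNIV. c' i) < (\<Sum>i\<in>UNIV. c i)"
        using i by (intro sum_strict_mono_ex1) auto
      then show False using less.prems(3) by simp
    qed
    then obtain j where j: "c j < c' j" by blast
    have ij: "i \<noteq> j" using i j by auto
    define b where "b = c(i := c i - 1)"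
    define e where "e = b(j := Suc (b j))"
    have c: "c = b(i := Suc (b i))"
      using i by (auto simp: b_def)
    have b: "b k \<le> d k" for k
      using less.prems(1)[of k] by (cases "k = i") (auto simp: b_def)
    have bi: "b i < d i" and bj: "b j < d j"
      using less.prems(1)[of i] less.prems(2)[of j] i j ij by (auto simp: b_def)
    have e_le: "e k \<le> d k" for k
      using b[of k] bj by (auto simp: e_def)
    have sum_upd: "(\<Sum>k\<in>UNIV. (b(r := Suc (b r))) k) = Suc (\<Sum>k\<in>UNIV. b k)" for r
      by (simp add: sum.remove[of UNIV r])
    have "(\<Sum>k\<in>UNIV. e k) = (\<Sum>k\<in>UNIV. c k)"
      unfolding e_def by (subst (2) c) (simp only: sum_upd)
    then have sum_e: "(\<Sum>k\<in>UNIV. e k) = (\<Sum>k\<in>UNIV. c' k)"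
      using less.prems(3) by simp
    have "(\<Sum>k\<in>UNIV. e k - c' k) < (\<Sum>k\<in>UNIV. c k - c' k)"
      using i j ij by (intro sum_strict_mono_ex1) (auto simp: e_def b_def intro!: exI[of _ i])
    then have "deformable d (diag_powers e) (diag_powers c')"
      using less.hyps e_le less.prems(2) sum_e by blast
    moreover have "deformable d (diag_powers c) (diag_powers e)"
      unfolding e_def by (subst c) (rule deformable_diag_powers_swap[of i j b d, OF ij bi bj b])
    ultimately show ?thesis
      by (rule homotopic_with_trans[rotated])
  qed
qed

lemma exists_bounded_sum:
  fixes d :: "'m::finite \<Rightarrow> nat"
  assumes "s \<le> (\<Sum>i\<in>UNIV. d i)"
  shows "\<exists>c. (\<forall>i. c i \<le> d i) \<and> (\<Sum>i\<in>UNIV. c i) = s"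
  using assms
proof (induction s)
  case 0
  show ?case by (intro exI[of _ "\<lambda>i. 0"]) simp
next
  case (Suc s)
  then obtain c where c: "\<And>i. c i \<le> d i" "(\<Sum>i\<in>UNIV. c i) = s" by auto
  have "\<exists>i. c i < d i"
  proof (rule ccontr)
    assume "\<nexists>i. c i < d i"
    then have "(\<Sum>i\<in>UNIV. d i) \<le> (\<Sum>i\<in>UNIV. c i)"
      by (intro sum_mono) (simp add: not_less)
    then show False using Suc.prems c(2) by simp
  qed
  then obtain i where i: "c i < d i" by blast
  have "(\<Sum>k\<in>UNIV. (c(i := Suc (c i))) k) = Suc s"
    using c(2) by (simp add: sum.remove[of UNIV i])
  moreover have "(c(i := Suc (c i))) k \<le> d k" for k
    using c(1) i by auto
  ultimately show ?case by blast
qed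

section \<open>Paths in spaces of continuous functions\<close>

text \<open>For a compact domain, a path in the supremum metric is the same as a jointly continuous
  function of the parameter and the point. In this direction it is uniform continuity.\<close>
lemma path_component_of_cfunspaceI:
  fixes h :: "real \<times> 'a::metric_space \<Rightarrow> 'b::metric_space"
  assumes S: "compact S" and h: "continuous_on ({0..1} \<times> S) h"
    and G: "\<And>t. t \<in> {0..1} \<Longrightarrow> restrict (\<lambda>z. h (t, z)) S \<in> G"
  shows "path_component_of
           (subtopology (mtopology_of (cfunspace (top_of_set S) euclidean_metric)) G)
           (restrict (\<lambda>z. h (0, z)) S) (restrict (\<lambda>z. h (1, z)) S)"
proof -
  let ?m = "cfunspace (top_of_set S) euclidean_metric :: ('a \<Rightarrow> 'b) metric"
  define g where "g t = restrict (\<lambda>z. h (t, z)) S" for t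
  interpret m: Metric_space "mspace ?m" "mdist ?m"
    by (rule Metric_space_mspace_mdist)
  have mspace: "g t \<in> mspace ?m" if t: "t \<in> {0..1}" for t
  proof -
    have cont: "continuous_on S (\<lambda>z. h (t, z))"
      using continuous_on_o_Pair[OF h t] by (simp add: o_def)
    then have "compact ((\<lambda>z. h (t, z)) ` S)"
      using S compact_continuous_image by blast
    then have "bounded (g t ` S)"
      by (simp add: g_def compact_imp_bounded)
    moreover have "continuous_on S (g t)"
      using cont by (simp add: g_def cong: continuous_on_cong)
    ultimately show ?thesis
      by (simp add: g_def)
  qed
  have "continuous_map (top_of_set {0..1}) m.mtopology g"
    unfolding m.continuous_map_to_metric
  proof (intro ballI allI impI)
    fix s and e :: real
    assume s: "s \<in> topspace (top_of_set {0..1::real})" and e: "e > 0"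
    have "uniformly_continuous_on ({0..1} \<times> S) h"
      by (intro compact_uniformly_continuous h compact_Times S) auto
    then obtain r where r: "r > 0"
      and close: "\<And>x y. x \<in> {0..1} \<times> S \<Longrightarrow> y \<in> {0..1} \<times> S \<Longrightarrow> dist y x < r \<Longrightarrow> dist (h y) (h x) < e/2"
      unfolding uniformly_continuous_on_def using half_gt_zero[OF e] by metis
    show "\<exists>U. openin (top_of_set {0..1}) U \<and> s \<in> U \<and> (\<forall>t\<in>U. g t \<in> m.mball (g s) e)"
    proof (intro exI conjI ballI)
      show "openin (top_of_set {0..1}) ({0..1} \<inter> ball s r)"
        by (simp add: openin_open_Int)
      show "s \<in> {0..1} \<inter> ball s r"
        using s r by simp
      fix t assume t: "t \<in> {0..1} \<inter> ball s r"
      have "mdist ?m (g s) (g t) \<le> e/2"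
      proof (rule mdist_cfunspace_le)
        fix z assume z: "z \<in> topspace (top_of_set S)"
        then show "mdist euclidean_metric (g s z) (g t z) \<le> e/2"
          using close[of "(t, z)" "(s, z)"] s t by (simp add: g_def dist_Pair_Pair)
      qed (use e in simp)
      then show "g t \<in> m.mball (g s) e"
        using mspace[of t] mspace[of s] s t e by (simp del: mspace_cfunspace)
    qed
  qed
  then have "pathin (subtopology (mtopology_of ?m) G) g"
    using G by (simp add: pathin_def mtopology_of_def continuous_map_in_subtopology g_def Pi_iff)
  then show ?thesis
    unfolding path_component_of_def g_def by blast
qed

text \<open>Evaluation is jointly continuous: for a nearby parameter the function is uniformly close to the one at
  the given parameter, and that one is continuous.\<close>
lemma path_component_of_cfunspaceE:
  fixes a b :: "'a::metric_space \<Rightarrow> 'b::metric_space"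
  assumes "path_component_of
           (subtopology (mtopology_of (cfunspace (top_of_set S) euclidean_metric)) G) a b"
  obtains h where "continuous_on ({0..1::real} \<times> S) h" "\<And>t. t \<in> {0..1} \<Longrightarrow> (\<lambda>z. h (t, z)) \<in> G"
    "\<And>z. h (0, z) = a z" "\<And>z. h (1, z) = b z"
proof -
  let ?m = "cfunspace (top_of_set S) euclidean_metric :: ('a \<Rightarrow> 'b) metric"
  interpret m: Metric_space "mspace ?m" "mdist ?m"
    by (rule Metric_space_mspace_mdist)
  obtain g where path: "pathin (subtopology (mtopology_of ?m) G) g" and ends: "g 0 = a" "g 1 = b"
    using assms by (auto simp: path_component_of_def)
  from path have g: "continuous_map (top_of_set {0..1}) m.mtopology g"
    and G: "\<And>t::real. t \<in> {0..1} \<Longrightarrow> g t \<in> G"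
    by (auto simp: pathin_def mtopology_of_def continuous_map_in_subtopology Pi_iff)
  have mspace: "g t \<in> mspace ?m" if "t \<in> {0..1}" for t :: real
    using g that by (auto simp: continuous_map_def simp del: mspace_cfunspace)
  have "continuous_on ({0..1::real} \<times> S) (\<lambda>(t, z). g t z)"
    unfolding continuous_on_iff
  proof (intro ballI allI impI)
    fix x :: "real \<times> 'a" and e :: real assume x: "x \<in> {0..1} \<times> S" and e: "e > 0"
    obtain s w where [simp]: "x = (s, w)" and s: "s \<in> {0..1}" and w: "w \<in> S"
      using x by blast
    obtain U where U: "openin (top_of_set {0..1}) U" "s \<in> U" "\<And>t. t \<in> U \<Longrightarrow> g t \<in> m.mball (g s) (e/2)"
      using g s half_gt_zero[OF e] unfolding m.continuous_map_to_metric by (metis topspace_subtopology_subset topspace_euclidean subset_UNIV)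
    then obtain r where r: "r > 0" "ball s r \<inter> {0..1} \<subseteq> U"
      by (meson openin_contains_ball)
    have "continuous_on S (g s)"
      using mspace[OF s] by simp
    then obtain r' where r': "r' > 0" "\<And>z. z \<in> S \<Longrightarrow> dist z w < r' \<Longrightarrow> dist (g s z) (g s w) < e/2"
      using w half_gt_zero[OF e] unfolding continuous_on_iff by metis
    show "\<exists>\<delta>>0. \<forall>y\<in>{0..1} \<times> S. dist y x < \<delta> \<longrightarrow>
             dist (case y of (t, z) \<Rightarrow> g t z) (case x of (t, z) \<Rightarrow> g t z) < e"
    proof (intro exI conjI ballI impI)
      show "min r r' > 0" using r r' by simp
      fix y assume y: "y \<in> {0..1} \<times> S" and close: "dist y x < min r r'"
      obtain t z where [simp]: "y = (t, z)" and t: "t \<in> {0..1}" and z: "z \<in> S"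
        using y by blast
      have "dist t s \<le> dist y x" "dist z w \<le> dist y x"
        using dist_fst_le[of y x] dist_snd_le[of y x] by auto
      then have "dist s t < r" "dist z w < r'"
        using close by (auto simp: dist_commute)
      then have "g t \<in> m.mball (g s) (e/2)"
        using U r t by auto
      then have "mdist ?m (g s) (g t) \<le> e/2"
        by (simp del: mspace_cfunspace)
      then have "dist (g s z) (g t z) \<le> e/2"
        using mdist_cfunspace_imp_mdist_le[OF mspace[OF s] mspace[OF t], of "e/2" z] z by simp
      moreover have "dist (g s z) (g s w) < e/2"
        using r' z \<open>dist z w < r'\<close> by blast
      ultimately show "dist (case y of (t, z) \<Rightarrow> g t z) (case x of (t, z) \<Rightarrow> g t z) < e"
        using dist_triangle[of "g t z" "g s w" "g s z"] by (simp add: dist_commute)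
    qed
  qed
  then show ?thesis
    using G ends by (intro that[of "\<lambda>(t, z). g t z"]) auto
qed

section \<open>Laurent polynomials and the winding number of the determinant\<close>

text \<open>Multiplication by $z^{1-n}$ maps the matrix polynomials of degree at most $2(n-1)$ onto the
  Fejer--Riesz system. The values off the circle are those required of its elements.\<close>
definition laurent_shift :: "nat \<Rightarrow> (complex \<Rightarrow> complex^'m^'m) \<Rightarrow> complex \<Rightarrow> complex^'m^'m" where
  "laurent_shift n f = restrict (\<lambda>z. map_matrix ((*) (z powi (1 - int n))) (f z)) circle"

lemma det_map_matrix_mult: "det (map_matrix ((*) c) (A :: 'a::comm_ring_1^'m^'m)) = c ^ CARD('m) * det A"
proof -
  have "map_matrix ((*) c) A = (\<chi> i. c *s A $ i)"
    by (simp add: vec_eq_iff)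
  then show ?thesis
    using det_rows_mul[of "\<lambda>i. c" "\<lambda>i. A $ i"] by simp
qed

lemma continuous_on_scalar_powi:
  fixes f :: "'b::topological_space \<Rightarrow> complex^'m^'m"
  assumes "continuous_on S f" "continuous_on S g" "\<And>x. x \<in> S \<Longrightarrow> g x \<noteq> 0"
  shows "continuous_on S (\<lambda>x. map_matrix ((*) (g x powi k)) (f x))"
  unfolding map_matrix_def using assms(3)
  by (intro continuous_on_vec_lambda continuous_on_mult continuous_on_power_int continuous_on_component assms(1,2)) auto

lemma continuous_on_circle_imp_mspace:
  assumes "continuous_on circle f"
  shows "restrict f circle \<in> mspace circle_matrix_functions"
proof -
  have "bounded (f ` circle)"
    by (intro compact_imp_bounded compact_continuous_image assms) simp
  moreover have "continuous_on circle (restrict f circle)"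
    using assms by (rule continuous_on_eq) simp
  ultimately show ?thesis
    by (simp add: circle_matrix_functions_def)
qed

lemma laurent_shift_in_fejer_riesz_invertible:
  assumes n: "n \<ge> 1" and f: "regular (\<lambda>_. 2 * (n - 1)) f"
  shows "laurent_shift n f \<in> fejer_riesz_invertible n"
proof -
  obtain M where M: "row_bounded (\<lambda>_. 2 * (n - 1)) M" "\<And>z. z \<in> circle \<Longrightarrow> f z = eval_mat M z"
    using f by (auto simp: regular_def)
  \<comment> \<open>The coefficient of $z^k$ comes from degree $k+n-1$ of the polynomial.\<close>
  define c where "c k = (\<chi> i j. coeff (M $ i $ j) (nat (k + int n - 1)))" for k
  have "laurent_shift n f z = (\<Sum>k = - int n + 1..int n - 1. map_matrix ((*) (z powi k)) (c k))" if z: "z \<in> circle" for z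
  proof -
    have z0: "z \<noteq> 0" using z by auto
    have "laurent_shift n f z $ i $ j = (\<Sum>k = - int n + 1..int n - 1. map_matrix ((*) (z powi k)) (c k)) $ i $ j" for i j
    proof -
      have deg: "degree (M $ i $ j) \<le> 2 * (n - 1)"
        using row_boundedD[OF M(1)] .
      have "laurent_shift n f z $ i $ j = z powi (1 - int n) * (\<Sum>k\<le>2 * (n - 1). coeff (M $ i $ j) k * z ^ k)"
        using z arg_cong[OF poly_as_sum_of_monoms'[OF deg], of "\<lambda>p. poly p z"]
        by (simp add: laurent_shift_def M(2) poly_sum poly_monom)
      also have "\<dots> = (\<Sum>k\<le>2 * (n - 1). z powi (int k + 1 - int n) * coeff (M $ i $ j) k)"
        unfolding sum_distrib_left
      proof (intro sum.cong refl)
        fix k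
        have "z powi (int k + 1 - int n) = z powi (1 - int n) * z ^ k"
          using z0 power_int_add[of z "1 - int n" "int k"] by (simp add: algebra_simps)
        then show "z powi (1 - int n) * (coeff (M $ i $ j) k * z ^ k) = z powi (int k + 1 - int n) * coeff (M $ i $ j) k"
          by simp
      qed
      also have "\<dots> = (\<Sum>k = - int n + 1..int n - 1. z powi k * coeff (M $ i $ j) (nat (k + int n - 1)))"
        by (rule sum.reindex_bij_witness[of _ "\<lambda>k. nat (k + int n - 1)" "\<lambda>k. int k + 1 - int n"]) (use n in auto)
      finally show ?thesis
        by (simp add: c_def sum_component)
    qed
    then show ?thesis by (simp add: vec_eq_iff)
  qed
  moreover have "laurent_shift n f \<in> mspace circle_matrix_functions"
    unfolding laurent_shift_def
    by (intro continuous_on_circle_imp_mspace continuous_on_scalar_powi regular_imp_continuous[OF f] continuous_on_id) auto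
  moreover have "det (laurent_shift n f z) \<noteq> 0" if "z \<in> circle" for z
    using f that by (auto simp: laurent_shift_def det_map_matrix_mult regular_def)
  ultimately show ?thesis
    unfolding fejer_riesz_invertible_def fejer_riesz_def by blast
qed

lemma fejer_riesz_invertible_imp_laurent_shift:
  assumes n: "n \<ge> 1" and a: "a \<in> fejer_riesz_invertible n"
  obtains f where "regular (\<lambda>_. 2 * (n - 1)) f" "laurent_shift n f = a"
proof -
  obtain c where c: "\<And>z. z \<in> circle \<Longrightarrow> a z = (\<Sum>k = - int n + 1..int n - 1. map_matrix ((*) (z powi k)) (c k))"
    and mspace: "a \<in> mspace circle_matrix_functions" and det: "\<And>z. z \<in> circle \<Longrightarrow> det (a z) \<noteq> 0"
    using a by (auto simp: fejer_riesz_invertible_def fejer_riesz_def)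
  have ext: "a \<in> extensional circle"
    using mspace by (simp add: circle_matrix_functions_def)
  define M where "M = (\<chi> i j. \<Sum>k = - int n + 1..int n - 1. monom (c k $ i $ j) (nat (k + int n - 1)))"
  have eval: "eval_mat M z = map_matrix ((*) (z powi (int n - 1))) (a z)" if z: "z \<in> circle" for z
  proof -
    have z0: "z \<noteq> 0" using z by auto
    have key: "c k $ i $ j * z ^ nat (k + int n - 1) = z powi (int n - 1) * (z powi k * c k $ i $ j)"
      if "k \<in> {- int n + 1..int n - 1}" for k i j
    proof -
      have "z ^ nat (k + int n - 1) = z powi (k + int n - 1)"
        using that by (simp add: power_int_def)
      also have "\<dots> = z powi (int n - 1) * z powi k"
        using z0 power_int_add[of z "int n - 1" k] by (simp add: algebra_simps)
      finally show ?thesis by simp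
    qed
    have "poly (M $ i $ j) z = (\<Sum>k = - int n + 1..int n - 1. z powi (int n - 1) * (z powi k * c k $ i $ j))" for i j
      unfolding M_def vec_lambda_beta poly_sum poly_monom by (intro sum.cong refl key)
    then show ?thesis
      by (simp add: vec_eq_iff c[OF z] sum_component sum_distrib_left)
  qed
  have "row_bounded (\<lambda>_. 2 * (n - 1)) M"
    unfolding row_bounded_def M_def
    by (auto intro!: degree_sum_le order_trans[OF degree_monom_le])
  moreover have "det (eval_mat M z) \<noteq> 0" if "z \<in> circle" for z
    using that det[OF that] by (auto simp: eval det_map_matrix_mult)
  ultimately have "regular (\<lambda>_. 2 * (n - 1)) (eval_mat M)"
    by (rule regular_eval_mat)
  moreover have "laurent_shift n (eval_mat M) = a"
  proof (rule extensionalityI[OF _ ext])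
    show "laurent_shift n (eval_mat M) \<in> extensional circle"
      by (simp add: laurent_shift_def)
    fix z assume z: "z \<in> circle"
    have "z \<noteq> 0" using z by auto
    then have "z powi (1 - int n) * z powi (int n - 1) = 1"
      using power_int_add[of z "1 - int n" "int n - 1"] by simp
    then show "laurent_shift n (eval_mat M) z = a z"
      using z by (simp add: laurent_shift_def eval vec_eq_iff flip: mult.assoc)
  qed
  ultimately show ?thesis
    by (rule that)
qed

lemma deformable_imp_path_component:
  assumes n: "n \<ge> 1" and fg: "deformable (\<lambda>_. 2 * (n - 1)) f g"
  shows "path_component_of (fejer_riesz_invertible_topology n) (laurent_shift n f) (laurent_shift n g)"
proof -
  obtain h where h: "continuous_on ({0..1::real} \<times> circle) h" "\<forall>z\<in>circle. h (0, z) = f z"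
     "\<forall>z\<in>circle. h (1, z) = g z" "\<forall>t\<in>{0..1}. regular (\<lambda>_. 2 * (n - 1)) (\<lambda>z. h (t, z))"
    using fg unfolding deformable_iff by blast
  define H where "H x = map_matrix ((*) (snd x powi (1 - int n))) (h x)" for x
  have H: "restrict (\<lambda>z. H (t, z)) circle = laurent_shift n (\<lambda>z. h (t, z))" for t
    by (simp add: H_def laurent_shift_def)
  have "path_component_of (fejer_riesz_invertible_topology n)
      (restrict (\<lambda>z. H (0, z)) circle) (restrict (\<lambda>z. H (1, z)) circle)"
    unfolding fejer_riesz_invertible_topology_def circle_matrix_functions_def
  proof (rule path_component_of_cfunspaceI)
    show "continuous_on ({0..1} \<times> circle) H"
      unfolding H_def by (intro continuous_on_scalar_powi h(1) continuous_on_snd continuous_on_id) auto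
    show "restrict (\<lambda>z. H (t, z)) circle \<in> fejer_riesz_invertible n" if "t \<in> {0..1}" for t
      unfolding H using laurent_shift_in_fejer_riesz_invertible[OF n] h(4) that by blast
  qed simp
  moreover have "restrict (\<lambda>z. H (0, z)) circle = laurent_shift n f" "restrict (\<lambda>z. H (1, z)) circle = laurent_shift n g"
    using h(2,3) by (auto simp: H_def laurent_shift_def restrict_def)
  ultimately show ?thesis by simp
qed

text \<open>A path of functions gives a homotopy of the loops of determinants in the punctured plane.\<close>
lemma det_winding_path_component:
  assumes "path_component_of (fejer_riesz_invertible_topology n) a b"
  shows "det_winding a = det_winding b"
proof -
  obtain h where h: "continuous_on ({0..1::real} \<times> circle) h"
    "\<And>t. t \<in> {0..1} \<Longrightarrow> (\<lambda>z. h (t, z)) \<in> fejer_riesz_invertible n"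
    "\<And>z. h (0, z) = a z" "\<And>z. h (1, z) = b z"
    using path_component_of_cfunspaceE[OF assms[unfolded fejer_riesz_invertible_topology_def circle_matrix_functions_def]]
    by blast
  have circ: "circlepath 0 1 s \<in> circle" for s
    by (simp add: circlepath norm_mult)
  have "homotopic_loops (- {0}) (\<lambda>s. det (a (circlepath 0 1 s))) (\<lambda>s. det (b (circlepath 0 1 s)))"
    unfolding homotopic_loops
  proof (intro exI conjI ballI)
    let ?H = "\<lambda>x. det (h (fst x, circlepath 0 1 (snd x)))"
    show "continuous_on ({0..1} \<times> {0..1}) ?H"
      using circ by (intro continuous_on_det continuous_on_compose2[OF h(1)])
        (auto simp: circlepath intro!: continuous_intros)
    show "?H \<in> {0..1} \<times> {0..1} \<rightarrow> - {0}"
      using h(2) circ by (auto simp: fejer_riesz_invertible_def)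
    show "pathfinish (?H \<circ> Pair t) = pathstart (?H \<circ> Pair t)" for t
      by (simp add: pathfinish_def pathstart_def circlepath)
  qed (simp_all add: h)
  then show ?thesis
    unfolding det_winding_def by (rule winding_number_homotopic_loops)
qed

text \<open>The determinant is the monomial $z^k$ with the exponent \<open>k\<close> on the right-hand side, and the loop
  $t \mapsto e^{2\pi i k t}$ has the logarithm $2\pi i k t$.\<close>
lemma det_winding_diag_powers:
  "det_winding (laurent_shift n (diag_powers c :: complex \<Rightarrow> complex^'m^'m))
     = of_int (int (\<Sum>i\<in>UNIV. c i) - int CARD('m) * (int n - 1))"
proof -
  define k where "k = int (\<Sum>i\<in>UNIV. c i) - int CARD('m) * (int n - 1)"
  have "det (laurent_shift n (diag_powers c :: complex \<Rightarrow> complex^'m^'m) (circlepath 0 1 t))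
      = exp (2 * pi * \<i> * k * t)" for t
  proof -
    define z where "z = circlepath 0 1 t"
    have z: "z = exp (2 * pi * \<i> * t)"
      by (simp add: z_def circlepath)
    have "z \<in> circle"
      by (simp add: z_def circlepath norm_mult)
    then have "det (laurent_shift n (diag_powers c :: complex \<Rightarrow> complex^'m^'m) z)
        = (z powi (1 - int n)) ^ CARD('m) * z ^ (\<Sum>i\<in>UNIV. c i)"
      by (simp add: laurent_shift_def det_map_matrix_mult det_diag_powers)
    also have "\<dots> = z powi ((1 - int n) * int CARD('m)) * z powi int (\<Sum>i\<in>UNIV. c i)"
      by (simp only: power_int_mult power_int_of_nat)
    also have "\<dots> = z powi k"
      unfolding k_def by (subst power_int_add[symmetric]) (auto simp: z algebra_simps)
    also have "\<dots> = exp (2 * pi * \<i> * k * t)"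
      unfolding z by (simp add: exp_power_int algebra_simps)
    finally show ?thesis
      by (simp add: z_def)
  qed
  then have "det_winding (laurent_shift n (diag_powers c :: complex \<Rightarrow> complex^'m^'m))
      = winding_number (exp \<circ> (\<lambda>t. 2 * pi * \<i> * k * of_real t)) 0"
    by (simp add: det_winding_def o_def)
  also have "\<dots> = of_int k"
    by (subst winding_number_compose_exp)
       (auto simp: path_def pathfinish_def pathstart_def intro!: continuous_intros)
  finally show ?thesis
    by (simp add: k_def)
qed

theorem theorem4p7:
  fixes n :: nat
  assumes "n \<ge> 2"
  shows "\<exists>W :: (complex \<Rightarrow> complex^'m^'m) set \<Rightarrow> int.
    (\<forall>a \<in> fejer_riesz_invertible n.
       of_int (W (path_component_of_set (fejer_riesz_invertible_topology n) a)) = det_winding a) \<and>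
    bij_betw W (V1 n)
      {- (int CARD('m) * (int n - 1)) .. int CARD('m) * (int n - 1)}"
proof -
  let ?T = "fejer_riesz_invertible_topology n :: (complex \<Rightarrow> complex^'m^'m) topology"
  let ?G = "fejer_riesz_invertible n :: (complex \<Rightarrow> complex^'m^'m) set"
  let ?d = "\<lambda>_ :: 'm. 2 * (n - 1)"
  let ?diag = "\<lambda>c. laurent_shift n (diag_powers c) :: complex \<Rightarrow> complex^'m^'m"
  let ?r = "int CARD('m) * (int n - 1)"
  have n: "n \<ge> 1" using assms by simp
  have topspace: "topspace ?T = ?G"
    by (auto simp: fejer_riesz_invertible_topology_def fejer_riesz_invertible_def fejer_riesz_def)
  have two_r: "int (CARD('m) * (2 * (n - 1))) = 2 * ?r"
    using n by (simp add: of_nat_diff)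
  have normal_form: "\<exists>c. (\<forall>i. c i \<le> 2 * (n - 1)) \<and> path_component_of ?T a (?diag c)" if a: "a \<in> ?G" for a
  proof -
    obtain f where f: "regular ?d f" "laurent_shift n f = a"
      using fejer_riesz_invertible_imp_laurent_shift[OF n a] .
    obtain c where "\<forall>i. c i \<le> 2 * (n - 1)" "deformable ?d f (diag_powers c)"
      using deformable_to_diag_powers[OF f(1)] by blast
    then show ?thesis
      using deformable_imp_path_component[OF n] f(2) by blast
  qed
  define W :: "(complex \<Rightarrow> complex^'m^'m) set \<Rightarrow> int"
    where "W C = \<lfloor>Re (det_winding (SOME a. a \<in> C))\<rfloor>" for C
  have W_eq: "of_int (W (path_component_of_set ?T a)) = det_winding a" if a: "a \<in> ?G" for a
  proof -
    have "path_component_of ?T a a"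
      using a by (simp add: path_component_of_refl topspace)
    then have "path_component_of ?T a (SOME b. b \<in> path_component_of_set ?T a)"
      by (metis mem_Collect_eq someI)
    then have "det_winding (SOME b. b \<in> path_component_of_set ?T a) = det_winding a"
      using det_winding_path_component by metis
    moreover obtain c where "path_component_of ?T a (?diag c)"
      using normal_form[OF a] by blast
    then have "det_winding a = of_int (int (\<Sum>i\<in>UNIV. c i) - ?r)"
      using det_winding_path_component det_winding_diag_powers by metis
    ultimately show ?thesis
      unfolding W_def by (simp del: of_int_diff)
  qed
  have W_diag: "W (path_component_of_set ?T a) = int (\<Sum>i\<in>UNIV. c i) - ?r"
    if a: "a \<in> ?G" and c: "path_component_of ?T a (?diag c)" for a c
    using W_eq[OF a] det_winding_path_component[OF c] det_winding_diag_powers[of n c]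
    by (metis of_int_eq_iff)
  have "inj_on W (V1 n)"
  proof (rule inj_onI)
    fix C D assume CD: "C \<in> V1 n" "D \<in> V1 n" and eq: "W C = W D"
    obtain a b where a: "a \<in> ?G" "C = path_component_of_set ?T a" and b: "b \<in> ?G" "D = path_component_of_set ?T b"
      using CD by (auto simp: V1_def path_components_of_def topspace)
    obtain c where c: "\<And>i. c i \<le> 2 * (n - 1)" "path_component_of ?T a (?diag c)"
      using normal_form[OF a(1)] by blast
    obtain c' where c': "\<And>i. c' i \<le> 2 * (n - 1)" "path_component_of ?T b (?diag c')"
      using normal_form[OF b(1)] by blast
    have "int (\<Sum>i\<in>UNIV. c i) = int (\<Sum>i\<in>UNIV. c' i)"
      using eq W_diag[OF a(1) c(2)] W_diag[OF b(1) c'(2)] unfolding a(2) b(2) by linarith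
    then have "(\<Sum>i\<in>UNIV. c i) = (\<Sum>i\<in>UNIV. c' i)"
      by (simp only: of_nat_eq_iff)
    then have "deformable ?d (diag_powers c) (diag_powers c')"
      using c(1) c'(1) by (intro deformable_diag_powers) auto
    then have "path_component_of ?T (?diag c) (?diag c')"
      by (rule deformable_imp_path_component[OF n])
    then have "path_component_of ?T a b"
      using c(2) c'(2) path_component_of_trans path_component_of_sym by metis
    then show "C = D"
      unfolding a(2) b(2) using path_component_of_equiv by metis
  qed
  moreover have "W ` V1 n = {- ?r..?r}"
  proof
    show "W ` V1 n \<subseteq> {- ?r..?r}"
    proof
      fix k assume "k \<in> W ` V1 n"
      then obtain a where a: "a \<in> ?G" and k: "k = W (path_component_of_set ?T a)"
        by (auto simp: V1_def path_components_of_def topspace)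
      obtain c where c: "\<And>i. c i \<le> 2 * (n - 1)" "path_component_of ?T a (?diag c)"
        using normal_form[OF a] by blast
      have "(\<Sum>i\<in>UNIV. c i) \<le> (\<Sum>i\<in>(UNIV :: 'm set). 2 * (n - 1))"
        using c(1) by (intro sum_mono) auto
      then have "int (\<Sum>i\<in>UNIV. c i) \<le> int (CARD('m) * (2 * (n - 1)))"
        by (intro of_nat_mono) simp
      moreover have "0 \<le> int (\<Sum>i\<in>UNIV. c i)"
        by (rule of_nat_0_le_iff)
      ultimately show "k \<in> {- ?r..?r}"
        using two_r unfolding k W_diag[OF a c(2)] atLeastAtMost_iff by linarith
    qed
    show "{- ?r..?r} \<subseteq> W ` V1 n"
    proof
      fix k assume k: "k \<in> {- ?r..?r}"
      have "nat (k + ?r) \<le> CARD('m) * (2 * (n - 1))"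
        using k two_r unfolding atLeastAtMost_iff nat_le_iff by linarith
      then obtain c where c: "\<And>i :: 'm. c i \<le> 2 * (n - 1)" "(\<Sum>i\<in>UNIV. c i) = nat (k + ?r)"
        using exists_bounded_sum[of "nat (k + ?r)" ?d] by auto
      have diag: "?diag c \<in> ?G"
        using c(1) by (intro laurent_shift_in_fejer_riesz_invertible n regular_diag_powers)
      then have "path_component_of ?T (?diag c) (?diag c)"
        by (simp add: path_component_of_refl topspace)
      from W_diag[OF diag this] have "W (path_component_of_set ?T (?diag c)) = k"
        using c(2) k by (simp del: of_nat_sum)
      moreover have "path_component_of_set ?T (?diag c) \<in> V1 n"
        using diag by (auto simp: V1_def path_components_of_def topspace)
      ultimately show "k \<in> W ` V1 n" by blast
    qed
  qed
  ultimately have "bij_betw W (V1 n) {- ?r..?r}"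
    by (simp add: bij_betw_def)
  then show ?thesis
    using W_eq by blast
qed

end
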